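(* Assume the Schanuel Subset Conjecture (SSC) holds. Let $\alpha,\beta$ be algebraic numbers and let $P(x)\in\overline{\mathbb{Q}}[x]$ be a non-constant polynomial. Then for every value $\alpha^{\beta}=e^{\beta\lambda}$, where $\lambda\in\mathbb{C}$ is any logarithm of $\alpha$ (i.e. $e^{\lambda}=\alpha$), we have $$(\alpha^{\beta}-P(e))(\alpha^{\beta}-P(\pi))(\alpha^{\beta}-P(\log 2))\neq 0,$$ where $\log 2$ is the real natural logarithm of $2$.
   Context: $\overline{\mathbb{Q}}$ denotes the field of algebraic numbers. A set $X\subset\mathbb{C}$ is called $\overline{\mathbb{Q}}$-dependent on a set $Y\subset\mathbb{C}$ if $\overline{\mathbb{Q}}(X)\subset\overline{\mathbb{Q}}(Y)$. The Schanuel Subset Conjecture (SSC) is the statement: for every $n\ge1$ and all $\alpha_1,\dots,\alpha_n\in\mathbb{C}$ linearly independent over $\mathbb{Q}$, if the set $\{\alpha_1,\dots,\alpha_n,e^{\alpha_1},\dots,e^{\alpha_n}\}$ is $\overline{\mathbb{Q}}$-dependent on a subset $\{\beta_1,\dots,\beta_n\}$ of itself (with $n$ elements), then $\beta_1,\dots,\beta_n$ are algebraically independent over $\mathbb{Q}$. *)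

theory Defs
  imports
    "HOL-Analysis.Analysis"
    "HOL-Computational_Algebra.Polynomial"
    "HOL-Library.Poly_Mapping"
    "HOL-Algebra.Generated_Fields"
    "HOL-Algebra.Algebraic_Closure_Type"
begin

interpretation rat_complex: vector_space "\<lambda>(q::rat) (z::complex). of_rat q * z"
  by unfold_locales (simp_all add: algebra_simps of_rat_add of_rat_mult)

definition Qbar :: "complex set" where
  "Qbar = {z. Polynomial.algebraic z}"

definition Qbar_adjoin :: "complex set \<Rightarrow> complex set" where
  "Qbar_adjoin S = generate_field (ring_of_type_algebra :: complex ring) (Qbar \<union> S)"

definition Qbar_dependent_on :: "complex set \<Rightarrow> complex set \<Rightarrow> bool" where
  "Qbar_dependent_on S T \<longleftrightarrow> Qbar_adjoin S \<subseteq> Qbar_adjoin T"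

text \<open>
  A multivariate polynomial with rational coefficients and variables labelled by complex
  numbers is a finitely supported map from monomials to coefficients, a monomial being a
  finitely supported map from variables to exponents.
  The function below evaluates such a polynomial at the point
  at which each variable takes the value of its own label.
\<close>

definition eval_at_labels :: "((complex \<Rightarrow>\<^sub>0 nat) \<Rightarrow>\<^sub>0 rat) \<Rightarrow> complex" where
  "eval_at_labels p =
    (\<Sum>m\<in>Poly_Mapping.keys p. of_rat (Poly_Mapping.lookup p m) *
       (\<Prod>x\<in>Poly_Mapping.keys m. x ^ Poly_Mapping.lookup m x))"

definition rat_algebraically_independent :: "complex set \<Rightarrow> bool" where
  "rat_algebraically_independent B \<longleftrightarrow>
    (\<forall>p :: (complex \<Rightarrow>\<^sub>0 nat) \<Rightarrow>\<^sub>0 rat.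
       (\<forall>m\<in>Poly_Mapping.keys p. Poly_Mapping.keys m \<subseteq> B) \<longrightarrow>
       eval_at_labels p = 0 \<longrightarrow> p = 0)"

text \<open>
  Linear independence of a family is injectivity together with
  linear independence of its set of values.
\<close>

definition Schanuel_Subset_Conjecture :: bool where
  "Schanuel_Subset_Conjecture \<longleftrightarrow>
    (\<forall>n\<ge>1. \<forall>a :: nat \<Rightarrow> complex.
       inj_on a {1..n} \<longrightarrow> rat_complex.independent (a ` {1..n}) \<longrightarrow>
       (\<forall>B \<subseteq> a ` {1..n} \<union> (\<lambda>i. exp (a i)) ` {1..n}.
          card B = n \<longrightarrow>
          Qbar_dependent_on (a ` {1..n} \<union> (\<lambda>i. exp (a i)) ` {1..n}) B \<longrightarrow>
          rat_algebraically_independent B))"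

end

theory Submission
  imports Defs
begin

text \<open>
  In all three factors the argument \<open>u\<close> of \<open>P\<close> generates, over the algebraic numbers, the same field
  as \<open>\<gamma>, exp \<gamma>\<close> for some \<open>\<gamma> \<noteq> 0\<close> such that one of \<open>\<gamma>, exp \<gamma>\<close> is algebraic:
  take \<open>\<gamma> = 1\<close>, \<open>\<i> \<pi>\<close>, \<open>ln 2\<close>.
  Suppose \<open>exp (\<beta> l) = P(u)\<close>. The conjecture with \<open>n = 1\<close> gives the theorem of Hermite and Lindemann,
  hence \<open>u\<close>, \<open>P(u)\<close> and \<open>l\<close> are transcendental and \<open>\<beta>\<close> is irrational.
  If \<open>\<gamma>, l, \<beta> l\<close> are linearly independent over the rationals, then these numbers and their exponentials
  all depend on \<open>{\<gamma>, exp \<gamma>, y}\<close> for \<open>y\<close> either \<open>l\<close> or \<open>\<beta> l\<close> (both choices are needed, as one of them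
  might equal \<open>exp \<gamma>\<close>). Otherwise \<open>\<gamma>\<close> is an algebraic multiple of \<open>l\<close>; so \<open>\<gamma>\<close> is not algebraic,
  and \<open>l, \<beta> l\<close> and their exponentials depend on \<open>{l, exp l}\<close>. In either case the conjecture
  makes an algebraic number part of an algebraically independent set.
\<close>

section \<open>Algebraic numbers as multipliers of finite-dimensional rational spaces\<close>

text \<open>A ring of multipliers. When \<open>S\<close> is finite and contains 1, all its elements
  are algebraic, so algebraic numbers can be added and multiplied by placing them in one such
  ring.\<close>

definition span_stabilizer :: "complex set \<Rightarrow> complex set" where
  "span_stabilizer S = {c. \<forall>s\<in>S. c * s \<in> rat_complex.span S}"

lemma span_stabilizer_mult_span:
  assumes "c \<in> span_stabilizer S" "v \<in> rat_complex.span S"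
  shows "c * v \<in> rat_complex.span S"
  using assms(2)
proof (induction rule: rat_complex.span_induct_alt)
  case base
  show ?case by (simp add: rat_complex.span_zero)
next
  case (step q x y)
  have "of_rat q * (c * x) + c * y \<in> rat_complex.span S"
    using step assms(1)
    by (intro rat_complex.span_add rat_complex.span_scale) (auto simp: span_stabilizer_def)
  thus ?case by (simp add: algebra_simps)
qed

lemma span_stabilizer_add:
  "a \<in> span_stabilizer S \<Longrightarrow> b \<in> span_stabilizer S \<Longrightarrow> a + b \<in> span_stabilizer S"
  by (auto simp: span_stabilizer_def distrib_right intro: rat_complex.span_add)

lemma span_stabilizer_mult:
  "a \<in> span_stabilizer S \<Longrightarrow> b \<in> span_stabilizer S \<Longrightarrow> a * b \<in> span_stabilizer S"
  using span_stabilizer_mult_span[of a S] by (auto simp: span_stabilizer_def mult.assoc)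

lemma of_rat_in_span_stabilizer: "of_rat q \<in> span_stabilizer S"
  by (auto simp: span_stabilizer_def intro: rat_complex.span_scale rat_complex.span_base)

lemma rat_in_span_stabilizer: "x \<in> \<rat> \<Longrightarrow> x \<in> span_stabilizer S"
  using of_rat_in_span_stabilizer by (auto elim: Rats_cases)

text \<open>The powers of \<open>c\<close> lie in a finite-dimensional rational vector space.\<close>

lemma span_stabilizer_imp_algebraic:
  assumes "finite S" "1 \<in> S" "c \<in> span_stabilizer S"
  shows "Polynomial.algebraic c"
proof -
  define n where "n = card S"
  have pow: "c ^ k \<in> rat_complex.span S" for k
    using assms(2,3) by (induction k) (auto intro: rat_complex.span_base span_stabilizer_mult_span)
  show ?thesis
  \<comment> \<open>Dependence concerns the set of powers, so a coincidence of two powers is treated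
    apart; it gives a relation directly.\<close>
  proof (cases "inj_on (\<lambda>k. c ^ k) {..n}")
    case False
    then obtain i j where ij: "i < j" "c ^ i = c ^ j"
      unfolding inj_on_def by (metis linorder_neqE_nat)
    show ?thesis
    proof (rule algebraicI')
      let ?p = "Polynomial.monom 1 j - Polynomial.monom 1 i :: complex poly"
      have "Polynomial.coeff ?p j = 1" using ij by simp
      thus "?p \<noteq> 0" by (metis coeff_0 zero_neq_one)
      show "Polynomial.coeff ?p k \<in> \<rat>" for k by (simp add: Polynomial.coeff_monom)
      show "poly ?p c = 0" using ij by (simp add: poly_monom)
    qed
  next
    case True
    \<comment> \<open>There are \<open>n + 1\<close> distinct powers, one more than the size of the
      spanning set \<open>S\<close>.\<close>
    have "rat_complex.dependent ((\<lambda>k. c ^ k) ` {..n})"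
    proof (rule ccontr)
      assume "\<not> ?thesis"
      hence "card ((\<lambda>k. c ^ k) ` {..n}) \<le> card S"
        using rat_complex.independent_span_bound[OF assms(1)] pow by blast
      thus False using card_image[OF True] by (simp add: n_def)
    qed
    then obtain u where u: "\<exists>k\<le>n. u (c ^ k) \<noteq> 0"
        "(\<Sum>v\<in>(\<lambda>k. c ^ k) ` {..n}. of_rat (u v) * v) = 0"
      by (subst (asm) rat_complex.dependent_finite) auto
    let ?p = "\<Sum>k\<le>n. Polynomial.monom (of_rat (u (c ^ k)) :: complex) k"
    have cf: "Polynomial.coeff ?p k = (if k \<le> n then of_rat (u (c ^ k)) else 0)" for k
      by (simp add: Polynomial.coeff_sum Polynomial.coeff_monom)
    show ?thesis
    proof (rule algebraicI')
      show "?p \<noteq> 0" using u(1) cf by (metis coeff_0 of_rat_eq_0_iff)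
      show "Polynomial.coeff ?p k \<in> \<rat>" for k by (simp add: cf)
      show "poly ?p c = 0"
        using u(2) by (simp add: sum.reindex[OF True] poly_sum poly_monom o_def)
    qed
  qed
qed

text \<open>Multiplying \<open>S\<close> by the powers of \<open>u\<close> below the degree of
  \<open>p\<close> gives a space stable under \<open>u\<close>. The inverse of the leading
  coefficient is a hypothesis because the stabilizer is only known to be a ring, and it is needed to
  solve for the top power.\<close>

lemma span_stabilizer_adjoin_root:
  assumes "finite S" "p \<noteq> 0" "poly p u = 0"
    and "\<And>i. Polynomial.coeff p i \<in> span_stabilizer S"
    and "inverse (Polynomial.lead_coeff p) \<in> span_stabilizer S"
  obtains T where "finite T" "S \<subseteq> T" "span_stabilizer S \<subseteq> span_stabilizer T"
    "u \<in> span_stabilizer T"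
proof
  define d where "d = Polynomial.degree p"
  define T where "T = (\<lambda>(j, s). u ^ j * s) ` ({..<d} \<times> S)"
  have d: "d > 0"
  proof (rule ccontr)
    assume "\<not> d > 0"
    then obtain c where "p = [:c:]" unfolding d_def using degree_eq_zeroE by blast
    with assms(2,3) show False by simp
  qed
  have pow_span: "u ^ j * v \<in> rat_complex.span T" if "j < d" "v \<in> rat_complex.span S" for j v
    using that(2)
  proof (induction rule: rat_complex.span_induct_alt)
    case base
    show ?case by (simp add: rat_complex.span_zero)
  next
    case (step q x y)
    have "u ^ j * x \<in> rat_complex.span T"
      using step that by (intro rat_complex.span_base) (auto simp: T_def)
    hence "of_rat q * (u ^ j * x) + u ^ j * y \<in> rat_complex.span T"
      using step by (intro rat_complex.span_add rat_complex.span_scale)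
    thus ?case by (simp add: algebra_simps)
  qed
  show "finite T" using assms(1) by (simp add: T_def)
  show "S \<subseteq> T"
  proof
    fix s assume "s \<in> S"
    thus "s \<in> T" using d unfolding T_def by (intro image_eqI[of _ _ "(0, s)"]) auto
  qed
  show "span_stabilizer S \<subseteq> span_stabilizer T"
  proof
    fix c assume c: "c \<in> span_stabilizer S"
    have "c * (u ^ j * s) \<in> rat_complex.span T" if "j < d" "s \<in> S" for j s
      using pow_span[OF that(1), of "c * s"] c that
      by (simp add: span_stabilizer_def mult.left_commute[of c])
    thus "c \<in> span_stabilizer T" by (auto simp: span_stabilizer_def T_def)
  qed
  have "u * (u ^ j * s) \<in> rat_complex.span T" if js: "j < d" "s \<in> S" for j s
  proof (cases "Suc j < d")
    case True
    from pow_span[OF this, of s] js show ?thesis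
      by (simp add: rat_complex.span_base mult.assoc)
  next
    case False
    \<comment> \<open>Only here does the exponent leave the allowed range; the equation
      \<open>poly p u = 0\<close> rewrites \<open>u ^ d\<close> through lower powers.\<close>
    hence j: "d = Suc j" using js by simp
    let ?l = "Polynomial.lead_coeff p"
    have l: "?l \<noteq> 0" using assms(2) by simp
    have "(\<Sum>i<d. Polynomial.coeff p i * u ^ i) + ?l * u ^ d = 0"
      using assms(3) by (simp add: poly_altdef d_def lessThan_Suc_atMost[symmetric])
    hence "?l * u ^ d = - (\<Sum>i<d. Polynomial.coeff p i * u ^ i)"
      by (simp add: eq_neg_iff_add_eq_0 add.commute)
    hence "u ^ d = - (inverse ?l * (\<Sum>i<d. Polynomial.coeff p i * u ^ i))"
      using l by (metis left_inverse mult.assoc mult_1 mult_minus_right)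
    hence "u ^ d * s = - (\<Sum>i<d. u ^ i * ((inverse ?l * Polynomial.coeff p i) * s))"
      by (simp add: sum_distrib_left sum_distrib_right mult_ac)
    moreover have "(inverse ?l * Polynomial.coeff p i) * s \<in> rat_complex.span S" for i
      using span_stabilizer_mult[OF assms(5) assms(4)] js by (simp add: span_stabilizer_def)
    ultimately have "u ^ d * s \<in> rat_complex.span T"
      by (auto intro!: rat_complex.span_neg rat_complex.span_sum pow_span)
    thus ?thesis by (simp add: j mult.assoc)
  qed
  thus "u \<in> span_stabilizer T" by (auto simp: span_stabilizer_def T_def)
qed

text \<open>The elements are adjoined one at a time; the earlier ones are kept because the
  stabilizers only grow.\<close>

lemma finite_Qbar_subset_span_stabilizer:
  assumes "finite A" "A \<subseteq> Qbar"
  obtains S where "finite S" "1 \<in> S" "A \<subseteq> span_stabilizer S"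
proof -
  have "\<exists>S. finite S \<and> 1 \<in> S \<and> A \<subseteq> span_stabilizer S"
    using assms
  proof (induction rule: finite_induct)
    case empty
    show ?case by (rule exI[of _ "{1}"]) simp
  next
    case (insert a A)
    then obtain S where S: "finite S" "1 \<in> S" "A \<subseteq> span_stabilizer S" by auto
    from insert obtain p where p: "p \<noteq> 0" "poly p a = 0" "\<And>i. Polynomial.coeff p i \<in> \<rat>"
      by (auto simp: Qbar_def algebraic_altdef)
    obtain T where "finite T" "S \<subseteq> T" "span_stabilizer S \<subseteq> span_stabilizer T"
        "a \<in> span_stabilizer T"
      using span_stabilizer_adjoin_root[OF S(1) p(1,2)] p(3) rat_in_span_stabilizer
      by (metis Rats_inverse)
    with S show ?case by (intro exI[of _ T]) auto
  qed
  thus ?thesis using that by blast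
qed

text \<open>One stabilizer contains all the coefficients and the inverse of the leading one, so the
  root can be adjoined to it.\<close>

lemma Qbar_root:
  assumes "p \<noteq> 0" "poly p u = 0" "\<And>i. Polynomial.coeff p i \<in> Qbar"
  shows "u \<in> Qbar"
proof -
  \<comment> \<open>The 0 covers the coefficients beyond the degree.\<close>
  let ?A = "insert (inverse (Polynomial.lead_coeff p)) (insert 0 (set (coeffs p)))"
  have "set (coeffs p) \<subseteq> Qbar"
    using assms(3) by (auto simp: coeffs_def)
  moreover have "inverse (Polynomial.lead_coeff p) \<in> Qbar"
    using assms(3)[of "Polynomial.degree p"] by (auto simp: Qbar_def)
  ultimately have "?A \<subseteq> Qbar" by (auto simp: Qbar_def)
  then obtain S where S: "finite S" "1 \<in> S" "?A \<subseteq> span_stabilizer S"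
    by (rule finite_Qbar_subset_span_stabilizer[rotated]) auto
  have "Polynomial.coeff p i \<in> span_stabilizer S" for i
    using S(3) range_coeff[of p] by blast
  moreover have "inverse (Polynomial.lead_coeff p) \<in> span_stabilizer S"
    using S(3) by simp
  ultimately obtain T where "finite T" "S \<subseteq> T" "span_stabilizer S \<subseteq> span_stabilizer T"
      "u \<in> span_stabilizer T"
    by (rule span_stabilizer_adjoin_root[OF S(1) assms(1,2)])
  thus ?thesis using S(2) span_stabilizer_imp_algebraic[of T u] by (auto simp: Qbar_def)
qed

section \<open>Closure properties of the field of algebraic numbers\<close>

lemma Qbar_add: "x \<in> Qbar \<Longrightarrow> y \<in> Qbar \<Longrightarrow> x + y \<in> Qbar"
  and Qbar_mult: "x \<in> Qbar \<Longrightarrow> y \<in> Qbar \<Longrightarrow> x * y \<in> Qbar"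
proof -
  assume "x \<in> Qbar" "y \<in> Qbar"
  then obtain S where S: "finite S" "1 \<in> S" "{x, y} \<subseteq> span_stabilizer S"
    using finite_Qbar_subset_span_stabilizer[of "{x, y}"] by auto
  thus "x + y \<in> Qbar" "x * y \<in> Qbar"
    using span_stabilizer_imp_algebraic[OF S(1,2)] span_stabilizer_add span_stabilizer_mult
    by (auto simp: Qbar_def)
qed

lemma Qbar_inverse: "x \<in> Qbar \<Longrightarrow> inverse x \<in> Qbar"
  by (auto simp: Qbar_def)

lemma Qbar_rat: "x \<in> \<rat> \<Longrightarrow> x \<in> Qbar"
  by (auto simp: Qbar_def rat_imp_algebraic)

lemma Qbar_power: "x \<in> Qbar \<Longrightarrow> x ^ n \<in> Qbar"
  by (induction n) (auto intro: Qbar_mult Qbar_rat)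

lemma Qbar_power_int: "x \<in> Qbar \<Longrightarrow> x powi n \<in> Qbar"
  by (auto simp: power_int_def intro: Qbar_power Qbar_inverse)

lemma Qbar_nth_root:
  assumes "x ^ n \<in> Qbar" "n > 0"
  shows "x \<in> Qbar"
  using assms algebraic_root[of "x ^ n" "Polynomial.monom 1 n" x]
  by (simp add: Qbar_def poly_monom Polynomial.degree_monom_eq Polynomial.coeff_monom)

text \<open>The number \<open>x\<close> is a root of \<open>P\<close> minus the constant
  \<open>poly P x\<close>, which is nonzero as \<open>P\<close> is not constant.\<close>

lemma Qbar_poly_arg:
  assumes "poly P x \<in> Qbar" "\<forall>i. Polynomial.coeff P i \<in> Qbar" "Polynomial.degree P > 0"
  shows "x \<in> Qbar"
proof (rule Qbar_root)
  let ?p = "P + [:- poly P x:]"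
  have "Polynomial.degree ?p = Polynomial.degree P"
    using assms(3) by (intro degree_add_eq_left) auto
  thus "?p \<noteq> 0" using assms(3) by fastforce
  show "poly ?p x = 0" by simp
  show "Polynomial.coeff ?p i \<in> Qbar" for i
    unfolding Polynomial.coeff_add using assms
    by (intro Qbar_add) (auto simp: coeff_pCons Qbar_def split: nat.splits)
qed

text \<open>A positive power of the number, the exponent being the denominator of \<open>q\<close>,
  is an integer power of \<open>exp l\<close>.\<close>

lemma Qbar_exp_rational_mult:
  assumes "exp l \<in> Qbar" "q \<in> \<rat>"
  shows "exp (q * l) \<in> Qbar"
proof -
  from assms(2) obtain a b where ab: "b > 0" "q = of_int a / of_int b"
    by (auto elim: Rats_cases')
  have "exp (q * l) ^ nat b = exp (of_int a * l)"
    using ab by (simp add: exp_of_nat_mult[symmetric])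
  also have "\<dots> = exp l powi a"
    by (simp add: exp_power_int mult.commute)
  finally have "exp (q * l) ^ nat b \<in> Qbar" using assms(1) by (simp add: Qbar_power_int)
  thus ?thesis using ab by (rule_tac Qbar_nth_root) auto
qed

section \<open>Fields generated over the algebraic numbers\<close>

lemma Qbar_adjoin_Qbar: "x \<in> Qbar \<Longrightarrow> x \<in> Qbar_adjoin S"
  by (simp add: Qbar_adjoin_def generate_field.incl)

lemma Qbar_adjoin_incl: "x \<in> S \<Longrightarrow> x \<in> Qbar_adjoin S"
  by (simp add: Qbar_adjoin_def generate_field.incl)

lemma Qbar_adjoin_add: "x \<in> Qbar_adjoin S \<Longrightarrow> y \<in> Qbar_adjoin S \<Longrightarrow> x + y \<in> Qbar_adjoin S"
  using generate_field.eng_add[of x "ring_of_type_algebra :: complex ring" "Qbar \<union> S" y]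
  by (simp add: Qbar_adjoin_def ring_of_type_algebra_def)

lemma Qbar_adjoin_mult: "x \<in> Qbar_adjoin S \<Longrightarrow> y \<in> Qbar_adjoin S \<Longrightarrow> x * y \<in> Qbar_adjoin S"
  using generate_field.eng_mult[of x "ring_of_type_algebra :: complex ring" "Qbar \<union> S" y]
  by (simp add: Qbar_adjoin_def ring_of_type_algebra_def)

lemma Qbar_adjoin_poly:
  assumes "x \<in> Qbar_adjoin S" "\<forall>i. Polynomial.coeff P i \<in> Qbar"
  shows "poly P x \<in> Qbar_adjoin S"
  using assms(2)
proof (induction P)
  case 0
  show ?case by (simp add: Qbar_adjoin_Qbar Qbar_rat)
next
  case (pCons a P)
  have "a \<in> Qbar" "\<forall>i. Polynomial.coeff P i \<in> Qbar"
    using pCons.prems by (metis coeff_pCons_0, metis coeff_pCons_Suc)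
  thus ?case using pCons.IH assms(1)
    by (auto intro: Qbar_adjoin_add Qbar_adjoin_mult Qbar_adjoin_Qbar)
qed

lemma Qbar_adjoin_subset:
  assumes "S \<subseteq> Qbar_adjoin T"
  shows "Qbar_adjoin S \<subseteq> Qbar_adjoin T"
proof -
  have "Qbar \<union> S \<subseteq> generate_field ring_of_type_algebra (Qbar \<union> T)"
    using assms by (auto simp: Qbar_adjoin_def generate_field.incl)
  thus ?thesis unfolding Qbar_adjoin_def
    by (intro field.generate_field_min_subfield1 field.generate_field_is_subfield
              field_from_type_algebra) (auto simp: ring_of_type_algebra_def)
qed

section \<open>Consequences of the conjecture\<close>

text \<open>An integer polynomial vanishing at an algebraic \<open>b\<close> is already a relation
  in the single variable labelled \<open>b\<close>.\<close>

lemma rat_algebraically_independent_disjoint_Qbar: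
  assumes "rat_algebraically_independent B"
  shows "B \<inter> Qbar = {}"
proof (rule ccontr)
  assume "B \<inter> Qbar \<noteq> {}"
  then obtain b where b: "b \<in> B" "Polynomial.algebraic b" by (auto simp: Qbar_def)
  from b(2) obtain q where q: "q \<noteq> 0" "poly (map_poly of_int q) b = (0 :: complex)"
    by (rule algebraicE')
  define d where "d = Polynomial.degree q"
  define p :: "(complex \<Rightarrow>\<^sub>0 nat) \<Rightarrow>\<^sub>0 rat" where
    "p = (\<Sum>k\<le>d. Poly_Mapping.single (Poly_Mapping.single b k) (of_int (Polynomial.coeff q k)))"
  have inj: "inj_on (Poly_Mapping.single b) {..d}"
    by (metis inj_onI lookup_single_eq)
  have lk: "Poly_Mapping.lookup p (Poly_Mapping.single b k) = of_int (Polynomial.coeff q k)"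
    if "k \<le> d" for k
  proof -
    have "Poly_Mapping.lookup p (Poly_Mapping.single b k) =
        (\<Sum>j\<le>d. if j = k then of_int (Polynomial.coeff q j) else 0)"
      unfolding p_def lookup_sum using inj that
      by (intro sum.cong) (auto simp: lookup_single when_def dest: inj_onD)
    thus ?thesis using that by simp
  qed
  have keys: "Poly_Mapping.keys p \<subseteq> Poly_Mapping.single b ` {..d}"
  proof -
    have "Poly_Mapping.keys p \<subseteq> (\<Union>k\<le>d. Poly_Mapping.keys (Poly_Mapping.single
            (Poly_Mapping.single b k) (of_int (Polynomial.coeff q k) :: rat)))"
      unfolding p_def by (rule Poly_Mapping.keys_sum)
    thus ?thesis by (auto split: if_splits)
  qed
  let ?ev = "\<lambda>m. of_rat (Poly_Mapping.lookup p m) *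
       (\<Prod>x\<in>Poly_Mapping.keys m. x ^ Poly_Mapping.lookup m x) :: complex"
  \<comment> \<open>Zero coefficients of \<open>q\<close> give no keys of \<open>p\<close>, so the
    sum is first extended to all exponents up to \<open>d\<close>.\<close>
  have "eval_at_labels p = sum ?ev (Poly_Mapping.single b ` {..d})"
    unfolding eval_at_labels_def
    by (intro sum.mono_neutral_left) (use keys in \<open>auto simp: in_keys_iff\<close>)
  also have "\<dots> = (\<Sum>k\<le>d. of_int (Polynomial.coeff q k) * b ^ k)"
    unfolding sum.reindex[OF inj] o_def by (intro sum.cong) (auto simp: lk)
  also have "\<dots> = 0"
    using q(2) by (simp add: poly_altdef d_def coeff_map_poly degree_map_poly)
  finally have "eval_at_labels p = 0" .
  moreover have "\<forall>m\<in>Poly_Mapping.keys p. Poly_Mapping.keys m \<subseteq> B"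
    using keys b(1) by (auto split: if_splits)
  ultimately have "p = 0"
    using assms by (simp add: rat_algebraically_independent_def)
  with lk[of d] q(1) show False by (simp add: d_def)
qed

text \<open>The conjecture restated for sets instead of indexed families, with its conclusion
  weakened to what contradictions below require.\<close>

lemma SSC_disjoint_Qbar:
  assumes "Schanuel_Subset_Conjecture" "finite A" "A \<noteq> {}" "rat_complex.independent A"
    and "B \<subseteq> A \<union> exp ` A" "card B = card A" "A \<union> exp ` A \<subseteq> Qbar_adjoin B"
  shows "B \<inter> Qbar = {}"
proof -
  obtain a where a: "bij_betw a {1..card A} A"
    using ex_bij_betw_nat_finite_1[OF assms(2)] by blast
  hence im: "a ` {1..card A} = A" "(\<lambda>i. exp (a i)) ` {1..card A} = exp ` A"
    by (auto simp: bij_betw_def image_image[symmetric])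
  have "card A \<ge> 1" using assms(2,3) by (simp add: Suc_leI card_gt_0_iff)
  moreover have "inj_on a {1..card A}" using a by (simp add: bij_betw_def)
  moreover have "Qbar_dependent_on (A \<union> exp ` A) B"
    using assms(7) by (simp add: Qbar_dependent_on_def Qbar_adjoin_subset)
  ultimately have "rat_algebraically_independent B"
    using assms(1,4-6) im unfolding Schanuel_Subset_Conjecture_def by metis
  thus ?thesis by (rule rat_algebraically_independent_disjoint_Qbar)
qed

text \<open>For nonzero \<open>x\<close>, both \<open>x\<close> and \<open>exp x\<close> would
  depend on \<open>{x}\<close>, an algebraic singleton.\<close>

lemma SSC_Hermite_Lindemann:
  assumes "Schanuel_Subset_Conjecture" "x \<in> Qbar" "exp x \<in> Qbar"
  shows "x = 0"
proof (rule ccontr)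
  assume "x \<noteq> 0"
  hence "rat_complex.independent {x}" by (simp add: rat_complex.dependent_single)
  hence "{x} \<inter> Qbar = {}"
    using assms by (intro SSC_disjoint_Qbar[of "{x}"]) (auto intro: Qbar_adjoin_Qbar)
  with assms(2) show False by simp
qed

section \<open>The common argument for the three factors\<close>

text \<open>The implication assumed for \<open>u\<close> serves to make \<open>u\<close>
  transcendental: otherwise \<open>\<gamma>\<close> would be a nonzero algebraic number with
  algebraic exponential.\<close>

lemma SSC_exp_mult_log_neq_poly:
  fixes \<beta> l \<gamma> u :: complex
  assumes SSC: "Schanuel_Subset_Conjecture"
    and \<alpha>: "exp l \<in> Qbar" and \<beta>: "\<beta> \<in> Qbar"
    and P: "\<forall>i. Polynomial.coeff P i \<in> Qbar" "Polynomial.degree P > 0"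
    and \<gamma>: "\<gamma> \<noteq> 0" "\<gamma> \<in> Qbar \<or> exp \<gamma> \<in> Qbar"
    and u: "u \<in> Qbar_adjoin {\<gamma>, exp \<gamma>}" "u \<in> Qbar \<Longrightarrow> \<gamma> \<in> Qbar \<and> exp \<gamma> \<in> Qbar"
  shows "exp (\<beta> * l) \<noteq> poly P u"
proof
  assume eq: "exp (\<beta> * l) = poly P u"
  have "u \<notin> Qbar" using SSC_Hermite_Lindemann[OF SSC, of \<gamma>] u(2) \<gamma>(1) by blast
  hence Pu: "poly P u \<notin> Qbar" using Qbar_poly_arg P by blast
  \<comment> \<open>If \<open>l\<close> were 0, then \<open>poly P u\<close> would be 1.\<close>
  have "l \<noteq> 0" using Pu eq by (auto simp: Qbar_rat)
  hence l: "l \<notin> Qbar" using SSC_Hermite_Lindemann[OF SSC _ \<alpha>] by blast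
  have \<beta>_irrat: "\<beta> \<notin> \<rat>" using Qbar_exp_rational_mult[OF \<alpha>] Pu eq by metis
  hence "\<beta> \<noteq> 0" "\<beta> \<noteq> 1" by auto
  have ind2: "rat_complex.independent {l, \<beta> * l}"
  proof -
    have "l \<notin> rat_complex.span {\<beta> * l}"
    proof
      assume "l \<in> rat_complex.span {\<beta> * l}"
      then obtain q where "l = of_rat q * (\<beta> * l)" by (auto simp: rat_complex.span_singleton)
      with \<open>l \<noteq> 0\<close> have "of_rat q * \<beta> = 1" by auto
      hence "\<beta> = inverse (of_rat q)" by (metis inverse_inverse_eq inverse_unique)
      with \<beta>_irrat show False by simp
    qed
    thus ?thesis using \<open>l \<noteq> 0\<close> \<open>\<beta> \<noteq> 0\<close>
      by (intro rat_complex.independent_insertI) (auto simp: rat_complex.dependent_single rat_complex.independent_empty)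
  qed
  have neq: "l \<noteq> \<beta> * l" using \<open>l \<noteq> 0\<close> \<open>\<beta> \<noteq> 1\<close> by auto
  show False
  proof (cases "\<gamma> \<in> rat_complex.span {l, \<beta> * l}")
    case True
    then obtain q r where "\<gamma> - of_rat q * l = of_rat r * (\<beta> * l)"
      by (auto simp: rat_complex.span_breakdown_eq[of _ l] rat_complex.span_singleton)
    hence \<gamma>_eq: "\<gamma> = (of_rat q + of_rat r * \<beta>) * l" (is "_ = ?c * l") by (simp add: algebra_simps)
    have c: "?c \<in> Qbar"
      using \<beta> by (intro Qbar_add Qbar_mult Qbar_rat[of "of_rat _"] Rats_of_rat)
    show False
    proof (cases "\<gamma> \<in> Qbar")
      case True
      have "?c \<noteq> 0" using \<gamma>_eq \<gamma>(1) by auto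
      hence "l = \<gamma> * inverse ?c" unfolding \<gamma>_eq
        by (metis mult.commute mult.assoc right_inverse mult_1)
      with True c l show False by (metis Qbar_inverse Qbar_mult)
    next
      case False
      \<comment> \<open>Here \<open>exp \<gamma>\<close> is algebraic and \<open>\<gamma>\<close> is
        an algebraic multiple of \<open>l\<close>, so \<open>u\<close>, and with it
        \<open>exp (\<beta> * l)\<close>, lies in the field generated by \<open>l\<close>. The set
        has two elements since \<open>l\<close> is transcendental and \<open>exp l\<close> is
        not.\<close>
      let ?B = "{l, exp l}"
      have lB: "l \<in> Qbar_adjoin ?B" by (simp add: Qbar_adjoin_incl)
      have "{\<gamma>, exp \<gamma>} \<subseteq> Qbar_adjoin ?B"
        using lB c False \<gamma>(2) by (auto simp: \<gamma>_eq intro: Qbar_adjoin_mult Qbar_adjoin_Qbar)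
      hence "u \<in> Qbar_adjoin ?B" using u(1) Qbar_adjoin_subset by blast
      hence "?B \<inter> Qbar = {}"
        using lB neq \<alpha> \<beta> l P(1) eq
        by (intro SSC_disjoint_Qbar[OF SSC _ _ ind2])
           (auto intro: Qbar_adjoin_mult Qbar_adjoin_Qbar Qbar_adjoin_poly simp: card_insert_if)
      with \<alpha> show False by simp
    qed
  next
    case False
    hence ind3: "rat_complex.independent {\<gamma>, l, \<beta> * l}"
      by (intro rat_complex.independent_insertI ind2)
    have \<gamma>_neq: "\<gamma> \<noteq> l" "\<gamma> \<noteq> \<beta> * l"
      using False by (auto intro: rat_complex.span_base)
    \<comment> \<open>Equality would make both numbers algebraic. Distinctness is needed for
      \<open>?B\<close> to have three elements.\<close>
    have exp_neq: "\<gamma> \<noteq> exp \<gamma>"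
      using SSC_Hermite_Lindemann[OF SSC, of \<gamma>] \<gamma> by metis
    obtain y where y: "y = l \<or> y = \<beta> * l" "y \<noteq> exp \<gamma>" using neq by metis
    let ?B = "{\<gamma>, exp \<gamma>, y}"
    have uB: "u \<in> Qbar_adjoin ?B"
      using u(1) Qbar_adjoin_subset[of "{\<gamma>, exp \<gamma>}" ?B] by (auto intro: Qbar_adjoin_incl)
    \<comment> \<open>Either choice of \<open>y\<close> recovers \<open>l\<close>, as
      \<open>\<beta>\<close> is algebraic and nonzero.\<close>
    have lB: "l \<in> Qbar_adjoin ?B"
    proof (cases "y = l")
      case False
      hence "l = inverse \<beta> * y" using y \<open>\<beta> \<noteq> 0\<close> by simp
      thus ?thesis
        using \<beta> by (auto intro!: Qbar_adjoin_mult intro: Qbar_adjoin_Qbar Qbar_inverse Qbar_adjoin_incl)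
    qed (auto intro: Qbar_adjoin_incl)
    have "?B \<inter> Qbar = {}"
    proof (rule SSC_disjoint_Qbar[OF SSC _ _ ind3])
      show "?B \<subseteq> {\<gamma>, l, \<beta> * l} \<union> exp ` {\<gamma>, l, \<beta> * l}" using y by auto
      show "card ?B = card {\<gamma>, l, \<beta> * l}" using y \<gamma>_neq exp_neq neq by auto
      show "{\<gamma>, l, \<beta> * l} \<union> exp ` {\<gamma>, l, \<beta> * l} \<subseteq> Qbar_adjoin ?B"
        using lB uB \<alpha> \<beta> P(1) eq
        by (auto intro: Qbar_adjoin_mult Qbar_adjoin_Qbar Qbar_adjoin_poly Qbar_adjoin_incl)
    qed auto
    with \<gamma>(2) show False by auto
  qed
qed

section \<open>Specialization to e, pi and log 2\<close>

theorem theorem3: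
  fixes \<alpha> \<beta> l :: complex and P :: "complex poly"
  assumes "Schanuel_Subset_Conjecture"
    and "\<alpha> \<in> Qbar" and "\<beta> \<in> Qbar"
    and "\<forall>i. Polynomial.coeff P i \<in> Qbar" and "Polynomial.degree P > 0"
    and "exp l = \<alpha>"
  shows "(exp (\<beta> * l) - poly P (exp 1)) *
         (exp (\<beta> * l) - poly P (of_real pi)) *
         (exp (\<beta> * l) - poly P (of_real (ln 2))) \<noteq> 0"
proof -
  have \<alpha>: "exp l \<in> Qbar" using assms(2,6) by simp
  note * = SSC_exp_mult_log_neq_poly[OF assms(1) \<alpha> assms(3-5)]
  have "exp (\<beta> * l) \<noteq> poly P (exp 1)"
    by (rule *[of 1]) (auto intro: Qbar_adjoin_incl Qbar_rat)
  moreover have "exp (\<beta> * l) \<noteq> poly P (of_real pi)"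
  \<comment> \<open>The exponential of this number is -1, and pi differs from it by an algebraic
    factor.\<close>
  proof (rule *[of "\<i> * of_real pi"])
    have i: "\<i> \<in> Qbar" "- \<i> \<in> Qbar" by (auto simp: Qbar_def)
    have "complex_of_real pi = - \<i> * (\<i> * of_real pi)" by simp
    thus "complex_of_real pi \<in> Qbar_adjoin {\<i> * of_real pi, exp (\<i> * of_real pi)}"
      using i(2) by (metis Qbar_adjoin_mult Qbar_adjoin_Qbar Qbar_adjoin_incl insertI1)
    show "\<i> * complex_of_real pi \<in> Qbar \<and> exp (\<i> * of_real pi) \<in> Qbar"
      if "complex_of_real pi \<in> Qbar"
      using that i(1) by (auto intro: Qbar_mult Qbar_rat)
  qed (auto intro: Qbar_rat)
  moreover have "exp (\<beta> * l) \<noteq> poly P (of_real (ln 2))"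
  proof (rule *[of "of_real (ln 2)"])
    have e: "exp (complex_of_real (ln 2)) = 2"
      by (metis exp_ln exp_of_real of_real_numeral zero_less_numeral)
    show "complex_of_real (ln 2) \<in> Qbar \<or> exp (complex_of_real (ln 2)) \<in> Qbar"
      by (simp add: e Qbar_rat)
    show "complex_of_real (ln 2) \<in> Qbar \<and> exp (complex_of_real (ln 2)) \<in> Qbar"
      if "complex_of_real (ln 2) \<in> Qbar"
      using that by (simp add: e Qbar_rat)
  qed (auto intro: Qbar_adjoin_incl)
  ultimately show ?thesis by simp
qed

end
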